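(* Let $G_n\sim G(n,1/2)$. There is an absolute constant $C>0$ and a deterministic sequence $\varepsilon_n^{\mathrm{left}}\ge0$ with $\varepsilon_n^{\mathrm{left}}\to0$ such that the following holds. Suppose deterministic integers $k_n\ge0$ and deterministic reals $\Lambda_n\ge0$ satisfy, for all sufficiently large $n$, $$\mathbb P(\zeta(G_n)\le k_n)\ge e^{-\Lambda_n}.\qquad( * )$$ Then for every deterministic choice $r=r(n)>0$, with the same $C$ and $\varepsilon_n^{\mathrm{left}}$ independent of $k_n,\Lambda_n,r$, the bound $$\mathbb P\Big(\zeta(G_n)>k_n+C\Big(\frac{\sqrt{n\Lambda_n}+\sqrt{nr}}{\log n}+n^{1/3}+1\Big)\Big)\le e^{-r}+\varepsilon_n^{\mathrm{left}}$$ holds at every sufficiently large $n$ for which $( * )$ holds.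
   Context: $G(n,1/2)$ is the random graph on $[n]$ with each edge present independently with probability $1/2$. The cochromatic number $\zeta(G)$ is the least number of parts in a partition of $V(G)$ in which every part is a clique or an independent set. $\log$ is natural. *)

theory Defs
  imports "HOL-Probability.Probability"
begin

text \<open>Simple graphs are given by a vertex set \<open>V\<close> and a set \<open>E\<close> of two-element
  subsets of \<open>V\<close>.\<close>

definition all_edges :: "'a set \<Rightarrow> 'a set set" where
  "all_edges V = {e. e \<subseteq> V \<and> card e = 2}"

definition is_clique :: "'a set set \<Rightarrow> 'a set \<Rightarrow> bool" where
  "is_clique E S \<longleftrightarrow> (\<forall>u\<in>S. \<forall>v\<in>S. u \<noteq> v \<longrightarrow> {u, v} \<in> E)"

definition is_independent :: "'a set set \<Rightarrow> 'a set \<Rightarrow> bool" where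
  "is_independent E S \<longleftrightarrow> (\<forall>u\<in>S. \<forall>v\<in>S. u \<noteq> v \<longrightarrow> {u, v} \<notin> E)"

definition cochromatic_number :: "'a set \<Rightarrow> 'a set set \<Rightarrow> nat" where
  "cochromatic_number V E =
     (LEAST k. \<exists>P. partition_on V P \<and> finite P \<and> card P = k \<and>
                   (\<forall>S\<in>P. is_clique E S \<or> is_independent E S))"

text \<open>The law of \<open>G(n,p)\<close> on the vertex set \<open>{1..n}\<close>, as a distribution on edge sets:
  the edge indicators are independent Bernoulli variables.\<close>

definition gnp :: "nat \<Rightarrow> real \<Rightarrow> nat set set pmf" where
  "gnp n p = map_pmf (\<lambda>f. {e \<in> all_edges {1..n}. f e})
                     (Pi_pmf (all_edges {1..n}) False (\<lambda>_. bernoulli_pmf p))"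

end

theory Submission
  imports Defs
begin

text \<open>Let \<open>Y\<close> be the least number of vertices whose deletion leaves a graph with cochromatic number
  at most \<open>k\<close>. Changing the edges at one vertex changes \<open>Y\<close> by at most one, so McDiarmid's inequality
  for the vertex exposure applies to \<open>Y\<close>. The lower tail and \<open>P(Y = 0) \<ge> exp (-\<Lambda>)\<close>
  give \<open>E Y \<le> sqrt (n \<Lambda>)\<close>; the upper tail gives \<open>Y \<le> E Y + sqrt (n r)\<close> outside an event of
  probability \<open>exp (-r)\<close>. By Ramsey's theorem \<^emph>\<open>every\<close> set of at least \<open>n powr (1/3)\<close> vertices contains a
  homogeneous set of size \<open>ln n / 10\<close>, so the deleted vertices are covered greedily by
  \<open>10 Y / ln n + n powr (1/3) + 1\<close> homogeneous sets. This step is deterministic, hence \<open>\<epsilon> = 0\<close> works.\<close>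

section \<open>McDiarmid's inequality for blocks of independent coordinates\<close>

lemma expectation_pair_pmf_finite:
  fixes f :: "'a \<times> 'b \<Rightarrow> real"
  assumes "finite (set_pmf p)" "finite (set_pmf q)"
  shows "measure_pmf.expectation (pair_pmf p q) f =
         measure_pmf.expectation p (\<lambda>x. measure_pmf.expectation q (\<lambda>y. f (x, y)))"
proof -
  have "pair_pmf p q = p \<bind> (\<lambda>x. map_pmf (Pair x) q)"
    by (simp add: pair_pmf_def map_pmf_def)
  also have "measure_pmf.expectation \<dots> f =
      (\<Sum>x\<in>set_pmf p. pmf p x *\<^sub>R measure_pmf.expectation (map_pmf (Pair x) q) f)"
    using assms by (intro pmf_expectation_bind) auto
  also have "\<dots> = measure_pmf.expectation p (\<lambda>x. measure_pmf.expectation q (\<lambda>y. f (x, y)))"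
    using assms(1) by (subst integral_measure_pmf[where A = "set_pmf p"]) auto
  finally show ?thesis .
qed

text \<open>Bounded differences control only the oscillation of \<open>g\<close>, without naming a
  range. Starting the range at the infimum gives an interval of length \<open>c\<close>, as
  Hoeffding's lemma with constant 1/8 requires.\<close>

lemma Hoeffdings_lemma_oscillation:
  fixes g :: "'a \<Rightarrow> real" and p :: "'a pmf"
  assumes osc: "\<And>x y. \<bar>g x - g y\<bar> \<le> c" and "l > 0"
  shows "(\<integral>\<^sup>+x. exp (l * (g x - measure_pmf.expectation p g)) \<partial>p) \<le> ennreal (exp (l\<^sup>2 * c\<^sup>2 / 8))"
proof -
  define a where "a = (INF x. g x)"
  have lower: "g y - c \<le> g x" for x y
    using osc[of y x] by linarith
  have "bdd_below (range g)"
    using lower by (auto intro!: bdd_belowI)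
  then have ge: "a \<le> g x" for x
    unfolding a_def by (rule cINF_lower) simp
  have le: "g x \<le> a + c" for x
    using lower cINF_greatest[of UNIV "g x - c" g] by (simp add: a_def)
  interpret interval_bounded_random_variable p g a "a + c"
    by unfold_locales (use ge le in auto)
  show ?thesis
    using Hoeffdings_lemma_nn_integral[OF \<open>l > 0\<close>] by simp
qed

lemma finite_set_Pi_pmf:
  assumes "finite A" "\<And>x. finite (set_pmf (p x))"
  shows "finite (set_pmf (Pi_pmf A d p))"
  using assms by (auto simp: set_Pi_pmf)

text \<open>The martingale argument, run as an induction on blocks. Averaging \<open>f\<close> over
  all blocks but \<open>i\<close> gives \<open>g\<close>. For a fixed value of block
  \<open>i\<close> the induction hypothesis controls \<open>f - g x\<close>, and Hoeffding's lemma
  controls \<open>g\<close> around its mean. The function varies in the induction because it is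
  applied to each section of \<open>f\<close>. Whole blocks, not single coordinates, are exposed so
  that a block can later be the edges assigned to one vertex.\<close>

lemma mgf_bounded_differences:
  fixes f :: "('a \<Rightarrow> 'b) \<Rightarrow> real" and p :: "'a \<Rightarrow> 'b pmf" and B :: "'i \<Rightarrow> 'a set" and c :: "'i \<Rightarrow> real" and d :: 'b
  assumes "finite I" "\<And>i. i \<in> I \<Longrightarrow> finite (B i)" "disjoint_family_on B I"
    and fin: "\<And>x. finite (set_pmf (p x))"
    and "\<And>i \<omega> \<omega>'. i \<in> I \<Longrightarrow> (\<And>x. x \<notin> B i \<Longrightarrow> \<omega> x = \<omega>' x) \<Longrightarrow> \<bar>f \<omega> - f \<omega>'\<bar> \<le> c i"
    and "l > 0"
  defines "P \<equiv> \<lambda>I. Pi_pmf (\<Union>i\<in>I. B i) d p"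
  shows "(\<integral>\<^sup>+\<omega>. exp (l * (f \<omega> - measure_pmf.expectation (P I) f)) \<partial>P I)
           \<le> ennreal (exp (l\<^sup>2 * (\<Sum>i\<in>I. (c i)\<^sup>2) / 8))"
  using assms(1-3,5)
proof (induction I arbitrary: f rule: finite_induct)
  case empty
  then show ?case by (simp add: P_def)
next
  case (insert i J)
  define Q where "Q = Pi_pmf (B i) d p"
  \<comment> \<open>\<open>h\<close> glues an assignment on block \<open>i\<close> to one on the
    remaining blocks.\<close>
  define h where "h = (\<lambda>(x, y) e. if e \<in> B i then x e else (y e :: 'b))"
  define g where "g = (\<lambda>x. measure_pmf.expectation (P J) (\<lambda>y. f (h (x, y))))"
  define K where "K = exp (l\<^sup>2 * (\<Sum>j\<in>J. (c j)\<^sup>2) / 8)"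
  have finB: "finite (B i)" "finite (\<Union>j\<in>J. B j)"
    using insert.prems(1) insert.hyps(1) by auto
  have disj: "B i \<inter> (\<Union>j\<in>J. B j) = {}"
    using insert.prems(2) insert.hyps(2) by (fastforce simp: disjoint_family_on_def)
  have PI: "P (insert i J) = map_pmf h (pair_pmf Q (P J))"
    using Pi_pmf_union[OF finB disj, of d p] by (simp add: P_def Q_def h_def case_prod_unfold)
  have finQ: "finite (set_pmf Q)" and finP: "finite (set_pmf (P J))"
    using finB fin by (auto simp: Q_def P_def intro!: finite_set_Pi_pmf)
  have E: "measure_pmf.expectation (P (insert i J)) f = measure_pmf.expectation Q g"
    by (simp add: PI expectation_pair_pmf_finite finQ finP g_def)
  have IH: "(\<integral>\<^sup>+y. exp (l * (f (h (x, y)) - g x)) \<partial>P J) \<le> ennreal K" for x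
    unfolding g_def K_def
  proof (rule insert.IH)
    show "disjoint_family_on B J"
      using insert.prems(2) by (auto simp: disjoint_family_on_def)
    show "\<bar>f (h (x, \<omega>)) - f (h (x, \<omega>'))\<bar> \<le> c j"
      if "j \<in> J" "\<And>e. e \<notin> B j \<Longrightarrow> \<omega> e = \<omega>' e" for j \<omega> \<omega>'
      using that by (intro insert.prems(3)) (auto simp: h_def)
  qed (use insert.prems(1) in auto)
  \<comment> \<open>\<open>h (x, y)\<close> and \<open>h (x', y)\<close> differ only on
    \<open>B i\<close>, so averaging over \<open>y\<close> preserves the bound
    \<open>c i\<close>.\<close>
  have osc: "\<bar>g x - g x'\<bar> \<le> c i" for x x'
  proof -
    have "\<bar>g x - g x'\<bar> = \<bar>measure_pmf.expectation (P J) (\<lambda>y. f (h (x, y)) - f (h (x', y)))\<bar>"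
      unfolding g_def
      by (subst Bochner_Integration.integral_diff) (auto intro: integrable_measure_pmf_finite finP)
    also have "\<dots> \<le> measure_pmf.expectation (P J) (\<lambda>y. \<bar>f (h (x, y)) - f (h (x', y))\<bar>)"
      by (rule integral_abs_bound)
    also have "\<dots> \<le> measure_pmf.expectation (P J) (\<lambda>y. c i)"
      by (intro integral_mono integrable_measure_pmf_finite finP insert.prems(3)) (auto simp: h_def)
    finally show ?thesis by simp
  qed
  have "(\<integral>\<^sup>+\<omega>. exp (l * (f \<omega> - measure_pmf.expectation (P (insert i J)) f)) \<partial>P (insert i J)) =
        (\<integral>\<^sup>+x. \<integral>\<^sup>+y. exp (l * (f (h (x, y)) - measure_pmf.expectation Q g)) \<partial>P J \<partial>Q)"
    unfolding E by (simp add: PI nn_integral_pair_pmf')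
  \<comment> \<open>The exponent is split as \<open>(g x - E g) + (f - g x)\<close>; the first term
    does not depend on \<open>y\<close> and leaves the inner integral.\<close>
  also have "\<dots> = (\<integral>\<^sup>+x. ennreal (exp (l * (g x - measure_pmf.expectation Q g))) *
                    (\<integral>\<^sup>+y. exp (l * (f (h (x, y)) - g x)) \<partial>P J) \<partial>Q)"
    by (subst nn_integral_cmult[symmetric])
       (auto simp: algebra_simps simp flip: ennreal_mult exp_add)
  also have "\<dots> \<le> (\<integral>\<^sup>+x. ennreal (exp (l * (g x - measure_pmf.expectation Q g))) * ennreal K \<partial>Q)"
    by (intro nn_integral_mono mult_left_mono IH) auto
  also have "\<dots> = (\<integral>\<^sup>+x. ennreal (exp (l * (g x - measure_pmf.expectation Q g))) \<partial>Q) * ennreal K"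
    by (rule nn_integral_multc) auto
  also have "\<dots> \<le> ennreal (exp (l\<^sup>2 * (c i)\<^sup>2 / 8)) * ennreal K"
    by (intro mult_right_mono Hoeffdings_lemma_oscillation osc \<open>l > 0\<close>) auto
  also have "\<dots> = ennreal (exp (l\<^sup>2 * (\<Sum>j\<in>insert i J. (c j)\<^sup>2) / 8))"
    using insert.hyps
    by (simp add: K_def algebra_simps add_divide_distrib flip: ennreal_mult exp_add)
  finally show ?case .
qed

lemma McDiarmid_ineq_ge:
  fixes f :: "('a \<Rightarrow> 'b) \<Rightarrow> real" and p :: "'a \<Rightarrow> 'b pmf" and B :: "'i \<Rightarrow> 'a set" and c :: "'i \<Rightarrow> real" and d :: 'b
  assumes "finite I" "\<And>i. i \<in> I \<Longrightarrow> finite (B i)" "disjoint_family_on B I"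
    and "\<And>x. finite (set_pmf (p x))"
    and "\<And>i \<omega> \<omega>'. i \<in> I \<Longrightarrow> (\<And>x. x \<notin> B i \<Longrightarrow> \<omega> x = \<omega>' x) \<Longrightarrow> \<bar>f \<omega> - f \<omega>'\<bar> \<le> c i"
    and "t \<ge> 0" "(\<Sum>i\<in>I. (c i)\<^sup>2) > 0"
  defines "P \<equiv> Pi_pmf (\<Union>i\<in>I. B i) d p"
  shows "measure_pmf.prob P {\<omega>. f \<omega> \<ge> measure_pmf.expectation P f + t}
           \<le> exp (- 2 * t\<^sup>2 / (\<Sum>i\<in>I. (c i)\<^sup>2))"
proof (cases "t = 0")
  case False
  define D where "D = (\<Sum>i\<in>I. (c i)\<^sup>2)"
  \<comment> \<open>This \<open>l\<close> minimises the Chernoff exponent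
    \<open>l\<^sup>2 * D / 8 - l * t\<close>, with minimum \<open>- 2 * t\<^sup>2 / D\<close>. It is
    positive only for \<open>t\<close> nonzero; for \<open>t = 0\<close> the claimed bound is
    1.\<close>
  define l where "l = 4 * t / D"
  have "D > 0" using assms(7) by (simp add: D_def)
  with False \<open>t \<ge> 0\<close> have "l > 0" by (simp add: l_def)
  define g where "g = (\<lambda>\<omega>. f \<omega> - measure_pmf.expectation P f)"
  have "ennreal (measure_pmf.prob P {\<omega>. g \<omega> \<ge> t}) = emeasure P {\<omega> \<in> space P. g \<omega> \<ge> t}"
    by (simp add: measure_pmf.emeasure_eq_measure)
  also have "\<dots> \<le> ennreal (exp (- l * t)) * (\<integral>\<^sup>+\<omega>\<in>space P. exp (l * g \<omega>) \<partial>P)"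
    by (intro Chernoff_ineq_nn_integral_ge \<open>l > 0\<close>) auto
  also have "\<dots> \<le> ennreal (exp (- l * t)) * ennreal (exp (l\<^sup>2 * D / 8))"
    using mgf_bounded_differences[where d = d, OF assms(1-5) \<open>l > 0\<close>]
    by (intro mult_left_mono) (simp_all add: g_def P_def D_def)
  also have "ennreal (exp (- l * t)) * ennreal (exp (l\<^sup>2 * D / 8)) = ennreal (exp (l\<^sup>2 * D / 8 - l * t))"
    by (simp flip: ennreal_mult exp_add)
  also have "l\<^sup>2 * D / 8 - l * t = - 2 * t\<^sup>2 / D"
    using \<open>D > 0\<close> by (simp add: l_def field_simps power2_eq_square)
  finally have "measure_pmf.prob P {\<omega>. g \<omega> \<ge> t} \<le> exp (- 2 * t\<^sup>2 / D)"
    by (subst (asm) ennreal_le_iff) auto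
  then show ?thesis
    by (simp add: g_def D_def algebra_simps)
qed simp

lemma McDiarmid_ineq_le:
  fixes f :: "('a \<Rightarrow> 'b) \<Rightarrow> real" and p :: "'a \<Rightarrow> 'b pmf" and B :: "'i \<Rightarrow> 'a set" and c :: "'i \<Rightarrow> real" and d :: 'b
  assumes "finite I" "\<And>i. i \<in> I \<Longrightarrow> finite (B i)" "disjoint_family_on B I"
    and "\<And>x. finite (set_pmf (p x))"
    and bd: "\<And>i \<omega> \<omega>'. i \<in> I \<Longrightarrow> (\<And>x. x \<notin> B i \<Longrightarrow> \<omega> x = \<omega>' x) \<Longrightarrow> \<bar>f \<omega> - f \<omega>'\<bar> \<le> c i"
    and "t \<ge> 0" "(\<Sum>i\<in>I. (c i)\<^sup>2) > 0"
  defines "P \<equiv> Pi_pmf (\<Union>i\<in>I. B i) d p"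
  shows "measure_pmf.prob P {\<omega>. f \<omega> \<le> measure_pmf.expectation P f - t}
           \<le> exp (- 2 * t\<^sup>2 / (\<Sum>i\<in>I. (c i)\<^sup>2))"
proof -
  have "\<bar>- f \<omega> - - f \<omega>'\<bar> \<le> c i" if "i \<in> I" "\<And>x. x \<notin> B i \<Longrightarrow> \<omega> x = \<omega>' x" for i \<omega> \<omega>'
  proof -
    have "\<bar>f \<omega> - f \<omega>'\<bar> \<le> c i" using that by (intro bd)
    then show ?thesis by linarith
  qed
  from McDiarmid_ineq_ge[where d = d, OF assms(1-4) this assms(6,7)]
  show ?thesis
    by (simp add: P_def algebra_simps)
qed

section \<open>Homogeneous covers\<close>

definition homogeneous :: "'a set set \<Rightarrow> 'a set \<Rightarrow> bool" where
  "homogeneous E S \<longleftrightarrow> is_clique E S \<or> is_independent E S"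

lemma homogeneous_subset: "homogeneous E S \<Longrightarrow> T \<subseteq> S \<Longrightarrow> homogeneous E T"
  unfolding homogeneous_def is_clique_def is_independent_def by blast

lemma homogeneous_singleton: "homogeneous E {v}"
  by (simp add: homogeneous_def is_clique_def)

lemma homogeneous_cong:
  assumes "\<And>u v. u \<in> S \<Longrightarrow> v \<in> S \<Longrightarrow> {u, v} \<in> E \<longleftrightarrow> {u, v} \<in> E'"
  shows "homogeneous E S \<longleftrightarrow> homogeneous E' S"
  using assms by (simp add: homogeneous_def is_clique_def is_independent_def)

text \<open>Homogeneity passes to subsets, so overlaps can be removed by assigning each vertex to
  one chosen set containing it. Covers are easier than partitions to unite and to extend.\<close>

lemma cochromatic_number_le_cover:
  assumes "finite P" "V \<subseteq> \<Union>P" "\<And>S. S \<in> P \<Longrightarrow> homogeneous E S"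
  shows "cochromatic_number V E \<le> card P"
proof -
  have "\<forall>v\<in>V. \<exists>S. S \<in> P \<and> v \<in> S" using assms(2) by blast
  then obtain c where c: "\<And>v. v \<in> V \<Longrightarrow> c v \<in> P \<and> v \<in> c v" by metis
  \<comment> \<open>A partition has no empty part, so sets that no vertex chose are
    discarded.\<close>
  define Q where "Q = (\<lambda>S. {v \<in> V. c v = S}) ` P - {{}}"
  have "finite Q" using assms(1) by (simp add: Q_def)
  moreover have "partition_on V Q"
    by (rule partition_onI) (use c in \<open>auto simp: Q_def disjnt_def\<close>)
  moreover have "is_clique E T \<or> is_independent E T" if T: "T \<in> Q" for T
  proof -
    obtain S where "S \<in> P" "T = {v \<in> V. c v = S}" using T by (auto simp: Q_def)
    with c have "T \<subseteq> S" by blast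
    from homogeneous_subset[OF assms(3)[OF \<open>S \<in> P\<close>] this] show ?thesis
      by (simp add: homogeneous_def)
  qed
  ultimately have "cochromatic_number V E \<le> card Q"
    unfolding cochromatic_number_def by (intro Least_le) blast
  also have "card Q \<le> card P"
    unfolding Q_def using assms(1) by (meson card_Diff1_le card_image_le finite_imageI le_trans)
  finally show ?thesis .
qed

text \<open>The partition into singletons shows that some number of parts is admissible, so the
  \<open>LEAST\<close> is attained.\<close>

lemma cochromatic_number_cover:
  assumes "finite V"
  obtains P where "finite P" "card P = cochromatic_number V E" "\<Union>P = V"
    "\<And>S. S \<in> P \<Longrightarrow> homogeneous E S"
proof -
  let ?A = "\<lambda>k. \<exists>P. partition_on V P \<and> finite P \<and> card P = k \<and>
                   (\<forall>S\<in>P. is_clique E S \<or> is_independent E S)"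
  have "partition_on V ((\<lambda>v. {v}) ` V)"
    by (auto intro!: partition_onI)
  then have "?A (card ((\<lambda>v. {v}) ` V))"
    using assms by (intro exI[of _ "(\<lambda>v. {v}) ` V"]) (auto simp: is_clique_def)
  then have "?A (cochromatic_number V E)"
    unfolding cochromatic_number_def by (rule LeastI)
  then show ?thesis
    using that by (auto simp: homogeneous_def dest: partition_onD1)
qed

section \<open>Ramsey's theorem and greedy covers\<close>

text \<open>Pick a vertex and keep the larger of its neighbourhood and non-neighbourhood: the size
  roughly halves while \<open>a\<close> or \<open>b\<close> drops by one. With
  \<open>a = b = h\<close> this yields the threshold \<open>4 ^ h\<close>.\<close>

lemma Ramsey_clique_independent:
  assumes "finite U" "2 ^ (a + b) \<le> card U"
  shows "\<exists>S\<subseteq>U. card S = a \<and> is_clique E S \<or> card S = b \<and> is_independent E S"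
  using assms
proof (induction "a + b" arbitrary: a b U)
  case 0
  then show ?case by (intro exI[of _ "{}"]) (auto simp: is_clique_def)
next
  case (Suc m)
  show ?case
  proof (cases "a = 0 \<or> b = 0")
    case True
    then show ?thesis
      by (intro exI[of _ "{}"]) (auto simp: is_clique_def is_independent_def)
  next
    case False
    then obtain a' b' where ab: "a = Suc a'" "b = Suc b'" by (auto simp: gr0_conv_Suc)
    with Suc.hyps(2) have m: "m = a' + b" "m = a + b'" by auto
    have card_U: "2 * 2 ^ m \<le> card U" using Suc.prems(2) Suc.hyps(2)[symmetric] by simp
    have "0 < (2::nat) ^ m" by simp
    with card_U have "U \<noteq> {}" by auto
    then obtain v where v: "v \<in> U" by blast
    define N where "N = {u \<in> U - {v}. {u, v} \<in> E}"
    define M where "M = {u \<in> U - {v}. {u, v} \<notin> E}"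
    have fin: "finite N" "finite M" using Suc.prems(1) by (auto simp: N_def M_def)
    have "card (N \<union> M) = card N + card M"
      using fin by (intro card_Un_disjoint) (auto simp: N_def M_def)
    moreover have "N \<union> M = U - {v}" by (auto simp: N_def M_def)
    ultimately have "card N + card M + 1 = card U"
      using card_Suc_Diff1[OF Suc.prems(1) v] by simp
    \<comment> \<open>If both were smaller than \<open>2 ^ m\<close>, their sum would be at most
      \<open>2 * 2 ^ m - 2\<close>, but removing \<open>v\<close> leaves at least
      \<open>2 * 2 ^ m - 1\<close> vertices.\<close>
    with card_U consider "2 ^ m \<le> card N" | "2 ^ m \<le> card M" by linarith
    then show ?thesis
    proof cases
      case 1
      with Suc.hyps(1)[OF m(1) fin(1)] m(1) obtain S where S: "S \<subseteq> N"
        "card S = a' \<and> is_clique E S \<or> card S = b \<and> is_independent E S" by auto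
      show ?thesis
      proof (cases "card S = b \<and> is_independent E S")
        case True
        then show ?thesis using S(1) by (auto simp: N_def)
      next
        case False
        have "finite S" "v \<notin> S" using S(1) fin(1) by (auto simp: N_def intro: finite_subset)
        moreover have "is_clique E (insert v S)"
          using False S by (auto simp: is_clique_def N_def insert_commute)
        ultimately show ?thesis
          using False S v by (intro exI[of _ "insert v S"]) (auto simp: ab N_def)
      qed
    next
      case 2
      with Suc.hyps(1)[OF m(2) fin(2)] m(2) obtain S where S: "S \<subseteq> M"
        "card S = a \<and> is_clique E S \<or> card S = b' \<and> is_independent E S" by auto
      show ?thesis
      proof (cases "card S = a \<and> is_clique E S")
        case True
        then show ?thesis using S(1) by (auto simp: M_def)
      next
        case False
        have "finite S" "v \<notin> S" using S(1) fin(2) by (auto simp: M_def intro: finite_subset)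
        moreover have "is_independent E (insert v S)"
          using False S by (auto simp: is_independent_def M_def insert_commute)
        ultimately show ?thesis
          using False S v by (intro exI[of _ "insert v S"]) (auto simp: ab M_def)
      qed
    qed
  qed
qed

text \<open>While at least \<open>m\<close> vertices remain, Ramsey's theorem supplies a homogeneous
  set of size exactly \<open>h\<close> to remove. This happens at most \<open>card S / h\<close>
  times, and the fewer than \<open>m\<close> vertices left are covered by singletons.\<close>

lemma greedy_homogeneous_cover:
  assumes "finite S" "h > 0" "4 ^ h \<le> m"
  shows "\<exists>P. finite P \<and> S \<subseteq> \<Union>P \<and> (\<forall>T\<in>P. homogeneous E T) \<and>
             real (card P) \<le> real (card S) / real h + real m"
  using assms(1)
proof (induction "card S" arbitrary: S rule: less_induct)
  case less
  show ?case
  proof (cases "card S < m")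
    case True
    have "card ((\<lambda>v. {v}) ` S) \<le> card S"
      using less.prems by (rule card_image_le)
    with True have "real (card ((\<lambda>v. {v}) ` S)) \<le> real m" by simp
    also have "\<dots> \<le> real (card S) / real h + real m" by simp
    finally show ?thesis
      using less.prems by (intro exI[of _ "(\<lambda>v. {v}) ` S"]) (auto simp: homogeneous_singleton)
  next
    case False
    have "(2::nat) ^ (h + h) = 4 ^ h" by (simp add: power_add flip: power_mult_distrib)
    with False assms(3) have "2 ^ (h + h) \<le> card S" by simp
    from Ramsey_clique_independent[OF less.prems this, of E]
    obtain T where T: "T \<subseteq> S" "card T = h" "homogeneous E T"
      by (auto simp: homogeneous_def)
    have finT: "finite T" using T(1) less.prems by (rule finite_subset)
    have card: "card (S - T) = card S - h" "h \<le> card S"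
      using card_Diff_subset[OF finT T(1)] card_mono[OF less.prems T(1)] T(2) by auto
    then have "card (S - T) < card S" using \<open>h > 0\<close> by simp
    from less.hyps[OF this] less.prems obtain P where P: "finite P" "S - T \<subseteq> \<Union>P"
      "\<forall>T\<in>P. homogeneous E T" "real (card P) \<le> real (card (S - T)) / real h + real m" by auto
    have "real (card (insert T P)) \<le> real (card P) + 1"
      using card_insert_le_m1[of "Suc (card P)" P T] by simp
    also have "\<dots> \<le> real (card S) / real h + real m"
      using P(4) card \<open>h > 0\<close> by (simp add: of_nat_diff diff_divide_distrib)
    finally show ?thesis
      using P T by (intro exI[of _ "insert T P"]) auto
  qed
qed

section \<open>The deletion number\<close>

text \<open>The cochromatic number itself also changes by at most one per vertex, but concentrating
  it directly would lose the factor \<open>1 / ln n\<close>. Counting deleted vertices gains this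
  factor, since they are afterwards covered in batches of logarithmic size.\<close>

definition deletion_number :: "nat \<Rightarrow> 'a set \<Rightarrow> 'a set set \<Rightarrow> nat" where
  "deletion_number k V E = (LEAST s. \<exists>S\<subseteq>V. card S = s \<and> cochromatic_number (V - S) E \<le> k)"

lemma deletion_number_le:
  "S \<subseteq> V \<Longrightarrow> cochromatic_number (V - S) E \<le> k \<Longrightarrow> deletion_number k V E \<le> card S"
  unfolding deletion_number_def by (rule Least_le) blast

text \<open>Deleting all of \<open>V\<close> leaves nothing to cover, so the \<open>LEAST\<close> is
  attained even for \<open>k = 0\<close>.\<close>

lemma deletion_number_witness:
  obtains S where "S \<subseteq> V" "card S = deletion_number k V E" "cochromatic_number (V - S) E \<le> k"
proof -
  have "cochromatic_number (V - V) E \<le> k"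
    using cochromatic_number_le_cover[of "{}" "V - V" E] by simp
  then have "\<exists>S\<subseteq>V. card S = card V \<and> cochromatic_number (V - S) E \<le> k"
    by blast
  from LeastI[of "\<lambda>s. \<exists>S\<subseteq>V. card S = s \<and> cochromatic_number (V - S) E \<le> k", OF this] that
  show ?thesis unfolding deletion_number_def by blast
qed

text \<open>Delete \<open>v\<close> along with an optimal set for \<open>E\<close>: what remains
  does not see the edges at \<open>v\<close>, so the old cover with \<open>v\<close> removed stays
  homogeneous for \<open>E'\<close>.\<close>

lemma deletion_number_Suc:
  assumes "finite V" "\<And>e. v \<notin> e \<Longrightarrow> e \<in> E \<longleftrightarrow> e \<in> E'"
  shows "deletion_number k V E' \<le> Suc (deletion_number k V E)"
proof -
  obtain S where S: "S \<subseteq> V" "card S = deletion_number k V E" "cochromatic_number (V - S) E \<le> k"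
    by (rule deletion_number_witness)
  obtain P where P: "finite P" "card P = cochromatic_number (V - S) E" "\<Union>P = V - S"
    "\<And>T. T \<in> P \<Longrightarrow> homogeneous E T"
    using cochromatic_number_cover[of "V - S" E] assms(1) by blast
  \<comment> \<open>The intersection is there because \<open>v\<close> is not assumed to lie in
    \<open>V\<close>.\<close>
  define S' where "S' = insert v S \<inter> V"
  have "homogeneous E' (T - {v})" if "T \<in> P" for T
    using homogeneous_subset[OF P(4)[OF that], of "T - {v}"] assms(2)
    by (subst homogeneous_cong[of _ E' E]) auto
  then have "cochromatic_number (V - S') E' \<le> card ((\<lambda>T. T - {v}) ` P)"
    using P(1,3) by (intro cochromatic_number_le_cover) (auto simp: S'_def)
  also have "\<dots> \<le> k"
    using card_image_le[OF P(1), of "\<lambda>T. T - {v}"] P(2) S(3) by linarith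
  finally have "deletion_number k V E' \<le> card S'"
    by (intro deletion_number_le) (auto simp: S'_def)
  also have "\<dots> \<le> card (insert v S)"
    using S(1) assms(1) by (intro card_mono) (auto simp: S'_def intro: finite_subset)
  also have "\<dots> \<le> Suc (card S)"
    by (rule card_insert_le_m1) auto
  finally show ?thesis using S(2) by simp
qed

text \<open>The deleted set depends on the graph, so it has to be covered by an argument valid for
  every vertex set.\<close>

lemma cochromatic_number_le_deletion_number:
  assumes "finite V" "h > 0" "4 ^ h \<le> m"
  shows "real (cochromatic_number V E) \<le> real k + real (deletion_number k V E) / real h + real m"
proof -
  obtain S where S: "S \<subseteq> V" "card S = deletion_number k V E" "cochromatic_number (V - S) E \<le> k"
    by (rule deletion_number_witness)
  obtain P where P: "finite P" "card P = cochromatic_number (V - S) E" "\<Union>P = V - S"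
    "\<And>T. T \<in> P \<Longrightarrow> homogeneous E T"
    using cochromatic_number_cover[of "V - S" E] assms(1) by blast
  have "finite S" using S(1) assms(1) by (rule finite_subset)
  from greedy_homogeneous_cover[OF this assms(2,3), of E]
  obtain Q where Q: "finite Q" "S \<subseteq> \<Union>Q" "\<forall>T\<in>Q. homogeneous E T"
    "real (card Q) \<le> real (card S) / real h + real m" by blast
  have "cochromatic_number V E \<le> card (P \<union> Q)"
    using P Q by (intro cochromatic_number_le_cover) auto
  also have "\<dots> \<le> card P + card Q" by (rule card_Un_le)
  finally have "real (cochromatic_number V E) \<le> real (card P) + real (card Q)" by linarith
  moreover have "real (card P) \<le> real k" using P(2) S(3) by simp
  ultimately show ?thesis using Q(4) unfolding S(2) by linarith
qed

section \<open>Vertex exposure and the tails of the deletion number\<close>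

lemma deletion_number_concentration:
  fixes k n :: nat and q :: real
  assumes "n > 0" "t \<ge> 0"
  defines "Y \<equiv> \<lambda>E. real (deletion_number k {1..n} E)"
  defines "\<mu> \<equiv> measure_pmf.expectation (gnp n q) Y"
  shows "measure_pmf.prob (gnp n q) {E. Y E \<ge> \<mu> + t} \<le> exp (- 2 * t\<^sup>2 / real n)"
    and "measure_pmf.prob (gnp n q) {E. Y E \<le> \<mu> - t} \<le> exp (- 2 * t\<^sup>2 / real n)"
proof -
  define V where "V = {1..n}"
  define A where "A = all_edges V"
  \<comment> \<open>Each edge is assigned to its larger endpoint. The blocks are then disjoint and
    exhaust the edges, and every edge in block \<open>i\<close> contains the vertex
    \<open>i\<close>.\<close>
  define B where "B = (\<lambda>i. {e \<in> A. Max e = i})"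
  define F where "F = (\<lambda>\<omega>. {e \<in> A. \<omega> e})"
  define P where "P = Pi_pmf A False (\<lambda>_. bernoulli_pmf q)"
  have edge: "finite e" "e \<noteq> {}" "e \<subseteq> V" if "e \<in> A" for e
    using that by (auto simp: A_def all_edges_def intro: card_ge_0_finite)
  have "finite A"
    by (rule finite_subset[of _ "Pow V"]) (auto simp: A_def all_edges_def V_def)
  then have finB: "finite (B i)" for i by (simp add: B_def)
  have disj: "disjoint_family_on B V" by (auto simp: disjoint_family_on_def B_def)
  have "Max e \<in> V" if "e \<in> A" for e
    using Max_in[OF edge(1,2)[OF that]] edge(3)[OF that] by blast
  then have UB: "(\<Union>i\<in>V. B i) = A" by (auto simp: B_def)
  have finV: "finite V" and sum: "(\<Sum>i\<in>V. (1::real)\<^sup>2) = real n" by (simp_all add: V_def)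
  have fin: "finite (set_pmf (bernoulli_pmf q))" by (rule finite_subset[of _ UNIV]) auto
  \<comment> \<open>Resampling block \<open>i\<close> alters only edges at \<open>i\<close>, so
    \<open>deletion_number_Suc\<close> in both directions gives the difference bound 1, and the
    squares sum to \<open>n\<close>.\<close>
  have lip: "\<bar>Y (F \<omega>) - Y (F \<omega>')\<bar> \<le> 1"
    if "i \<in> V" "\<And>e. e \<notin> B i \<Longrightarrow> \<omega> e = \<omega>' e" for i \<omega> \<omega>'
  proof -
    have *: "e \<in> F \<omega> \<longleftrightarrow> e \<in> F \<omega>'" if "i \<notin> e" for e
    proof (cases "e \<in> A")
      case True
      with Max_in[OF edge(1,2)[OF True]] that have "e \<notin> B i" by (auto simp: B_def)
      with \<open>\<And>e. e \<notin> B i \<Longrightarrow> \<omega> e = \<omega>' e\<close> show ?thesis by (simp add: F_def)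
    qed (simp add: F_def)
    have "deletion_number k V (F \<omega>') \<le> Suc (deletion_number k V (F \<omega>))"
      "deletion_number k V (F \<omega>) \<le> Suc (deletion_number k V (F \<omega>'))"
      using * by (auto intro!: deletion_number_Suc[OF finV, of i])
    then show ?thesis unfolding Y_def V_def[symmetric] by linarith
  qed
  have gnp: "gnp n q = map_pmf F P"
    by (simp add: gnp_def F_def P_def A_def V_def)
  have mu: "\<mu> = measure_pmf.expectation P (\<lambda>\<omega>. Y (F \<omega>))"
    by (simp add: \<mu>_def gnp)
  have n: "(\<Sum>i\<in>V. (1::real)\<^sup>2) > 0" using \<open>n > 0\<close> unfolding sum by simp
  show "measure_pmf.prob (gnp n q) {E. Y E \<ge> \<mu> + t} \<le> exp (- 2 * t\<^sup>2 / real n)"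
    using McDiarmid_ineq_ge[where f = "\<lambda>\<omega>. Y (F \<omega>)" and c = "\<lambda>_. 1" and p = "\<lambda>_. bernoulli_pmf q"
        and d = False, OF finV finB disj fin lip \<open>t \<ge> 0\<close> n]
    by (simp only: UB sum P_def[symmetric] mu[symmetric]) (simp add: gnp vimage_def)
  show "measure_pmf.prob (gnp n q) {E. Y E \<le> \<mu> - t} \<le> exp (- 2 * t\<^sup>2 / real n)"
    using McDiarmid_ineq_le[where f = "\<lambda>\<omega>. Y (F \<omega>)" and c = "\<lambda>_. 1" and p = "\<lambda>_. bernoulli_pmf q"
        and d = False, OF finV finB disj fin lip \<open>t \<ge> 0\<close> n]
    by (simp only: UB sum P_def[symmetric] mu[symmetric]) (simp add: gnp vimage_def)
qed

lemma deletion_number_upper_tail: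
  fixes k n :: nat and q \<Lambda> r :: real
  assumes "n > 0" "\<Lambda> \<ge> 0" "r \<ge> 0"
    and start: "measure_pmf.prob (gnp n q) {E. cochromatic_number {1..n} E \<le> k} \<ge> exp (- \<Lambda>)"
  shows "measure_pmf.prob (gnp n q)
           {E. real (deletion_number k {1..n} E) > sqrt (real n * \<Lambda>) + sqrt (real n * r)} \<le> exp (- r)"
proof -
  define Y where "Y = (\<lambda>E. real (deletion_number k {1..n} E))"
  define \<mu> where "\<mu> = measure_pmf.expectation (gnp n q) Y"
  have "\<mu> \<ge> 0" by (auto simp: \<mu>_def Y_def)
  have "exp (- \<Lambda>) \<le> measure_pmf.prob (gnp n q) {E. cochromatic_number {1..n} E \<le> k}"
    by (rule start)
  \<comment> \<open>On the starting event the empty deletion set gives \<open>Y E = 0\<close>.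
    Writing 0 as \<open>\<mu> - \<mu>\<close> fits the lower tail at deviation
    \<open>t = \<mu>\<close>.\<close>
  also have "\<dots> \<le> measure_pmf.prob (gnp n q) {E. Y E \<le> \<mu> - \<mu>}"
    using deletion_number_le[of "{}" "{1..n}" _ k]
    by (intro measure_pmf.finite_measure_mono) (auto simp: Y_def)
  also have "\<dots> \<le> exp (- 2 * \<mu>\<^sup>2 / real n)"
    unfolding \<mu>_def Y_def
    by (intro deletion_number_concentration(2) \<open>n > 0\<close>) (use \<open>\<mu> \<ge> 0\<close> in \<open>simp add: \<mu>_def Y_def\<close>)
  finally have "2 * \<mu>\<^sup>2 \<le> real n * \<Lambda>"
    using \<open>n > 0\<close> by (simp add: field_simps)
  moreover have "0 \<le> \<mu>\<^sup>2" by simp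
  ultimately have "\<mu>\<^sup>2 \<le> real n * \<Lambda>" by linarith
  then have mu: "\<mu> \<le> sqrt (real n * \<Lambda>)" by (rule real_le_rsqrt)
  have "measure_pmf.prob (gnp n q) {E. Y E > sqrt (real n * \<Lambda>) + sqrt (real n * r)}
      \<le> measure_pmf.prob (gnp n q) {E. Y E \<ge> \<mu> + sqrt (real n * r)}"
    using mu by (intro measure_pmf.finite_measure_mono) auto
  also have "\<dots> \<le> exp (- 2 * (sqrt (real n * r))\<^sup>2 / real n)"
    unfolding \<mu>_def Y_def
    by (intro deletion_number_concentration(1) \<open>n > 0\<close>) (use \<open>r \<ge> 0\<close> in simp)
  also have "\<dots> \<le> exp (- r)"
    using \<open>n > 0\<close> \<open>r \<ge> 0\<close> by simp
  finally show ?thesis by (simp add: Y_def)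
qed

section \<open>Choice of the Ramsey scale and conclusion\<close>

lemma eventually_Ramsey_scale:
  "\<forall>\<^sub>F n in sequentially. 4 ^ nat \<lceil>ln (real n) / 10\<rceil> \<le> nat \<lceil>real n powr (1/3)\<rceil>"
proof -
  have "filterlim (\<lambda>n. ln (real n)) at_top sequentially"
    by (rule filterlim_compose[OF ln_at_top filterlim_real_sequentially])
  \<comment> \<open>With \<open>4 \<le> exp 2\<close> and \<open>h \<le> ln n / 10 + 1\<close> the
    goal reduces to \<open>ln n / 5 + 2 \<le> ln n / 3\<close>, which is exactly
    \<open>ln n \<ge> 15\<close>.\<close>
  then have "\<forall>\<^sub>F n in sequentially. ln (real n) \<ge> 15"
    by (simp add: filterlim_at_top)
  then show ?thesis
    using eventually_gt_at_top[of 0]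
  proof eventually_elim
    case (elim n)
    define h where "h = nat \<lceil>ln (real n) / 10\<rceil>"
    have h: "real h \<le> ln (real n) / 10 + 1"
      using elim(1) unfolding h_def by linarith
    have "(4::real) \<le> exp 2"
      using exp_lower_Taylor_quadratic[of "2::real"] by simp
    then have "4 ^ h \<le> exp (2 :: real) ^ h"
      by (intro power_mono) auto
    also have "\<dots> = exp (2 * real h)"
      by (simp add: mult.commute flip: exp_of_nat_mult)
    also have "\<dots> \<le> exp (1/3 * ln (real n))"
      using h elim(1) by simp
    also have "\<dots> = real n powr (1/3)"
      using elim(2) by (simp add: powr_def)
    finally have "real (4 ^ h) \<le> real n powr (1/3)" by simp
    then show ?case unfolding h_def by linarith
  qed
qed

theorem lemma10p2:
  "\<exists>(C::real) (\<epsilon>::nat \<Rightarrow> real). C > 0 \<and> (\<forall>n. \<epsilon> n \<ge> 0) \<and> \<epsilon> \<longlonglongrightarrow> 0 \<and>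
     (\<forall>(k::nat \<Rightarrow> nat) (\<Lambda>::nat \<Rightarrow> real).
        (\<forall>n. \<Lambda> n \<ge> 0) \<longrightarrow>
        (\<forall>\<^sub>F n in sequentially.
           measure_pmf.prob (gnp n (1/2)) {E. cochromatic_number {1..n} E \<le> k n} \<ge> exp (- \<Lambda> n)) \<longrightarrow>
        (\<forall>r::nat \<Rightarrow> real. (\<forall>n. r n > 0) \<longrightarrow>
           (\<forall>\<^sub>F n in sequentially.
              measure_pmf.prob (gnp n (1/2)) {E. cochromatic_number {1..n} E \<le> k n} \<ge> exp (- \<Lambda> n) \<longrightarrow>
              measure_pmf.prob (gnp n (1/2))
                {E. real (cochromatic_number {1..n} E) >
                    real (k n) + C * ((sqrt (real n * \<Lambda> n) + sqrt (real n * r n)) / ln (real n)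
                                      + real n powr (1/3) + 1)}
              \<le> exp (- r n) + \<epsilon> n)))"
\<comment> \<open>The constant 10 comes from \<open>h \<ge> ln n / 10\<close>, which turns
  \<open>D / h\<close> into at most \<open>10 * (D / ln n)\<close>; it also absorbs
  \<open>m \<le> n powr (1/3) + 1\<close>.\<close>
proof (intro exI[of _ "10::real"] exI[of _ "\<lambda>_. 0::real"] conjI allI impI)
  fix k :: "nat \<Rightarrow> nat" and \<Lambda> r :: "nat \<Rightarrow> real"
  assume \<Lambda>: "\<forall>n. \<Lambda> n \<ge> 0" and r: "\<forall>n. r n > 0"
  show "\<forall>\<^sub>F n in sequentially.
      measure_pmf.prob (gnp n (1/2)) {E. cochromatic_number {1..n} E \<le> k n} \<ge> exp (- \<Lambda> n) \<longrightarrow>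
      measure_pmf.prob (gnp n (1/2))
        {E. real (cochromatic_number {1..n} E) >
            real (k n) + 10 * ((sqrt (real n * \<Lambda> n) + sqrt (real n * r n)) / ln (real n)
                              + real n powr (1/3) + 1)} \<le> exp (- r n) + 0"
    using eventually_Ramsey_scale eventually_gt_at_top[of 1]
  proof eventually_elim
    case (elim n)
    define h where "h = nat \<lceil>ln (real n) / 10\<rceil>"
    define m where "m = nat \<lceil>real n powr (1/3)\<rceil>"
    define D where "D = sqrt (real n * \<Lambda> n) + sqrt (real n * r n)"
    have ln: "ln (real n) > 0" using elim(2) by simp
    have h: "real h \<ge> ln (real n) / 10" and "h > 0"
      using ln unfolding h_def by linarith+
    have m: "real m \<le> real n powr (1/3) + 1"
      using powr_ge_zero[of "real n" "1/3"] unfolding m_def by linarith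
    have "4 ^ h \<le> m" using elim(1) by (simp add: h_def m_def)
    have bound: "real (cochromatic_number {1..n} E)
        \<le> real (k n) + 10 * (D / ln (real n) + real n powr (1/3) + 1)"
      if "real (deletion_number (k n) {1..n} E) \<le> D" for E
    proof -
      have "real (deletion_number (k n) {1..n} E) / real h \<le> D / (ln (real n) / 10)"
        using that h ln by (intro frac_le) auto
      also have "\<dots> = 10 * (D / ln (real n))" by simp
      finally have "real (deletion_number (k n) {1..n} E) / real h \<le> 10 * (D / ln (real n))" .
      with m cochromatic_number_le_deletion_number[OF finite_atLeastAtMost \<open>h > 0\<close> \<open>4 ^ h \<le> m\<close>, of 1 n E "k n"]
      show ?thesis
        using powr_ge_zero[of "real n" "1/3"] unfolding distrib_left by linarith
    qed
    show ?case
    proof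
      assume start: "exp (- \<Lambda> n) \<le> measure_pmf.prob (gnp n (1/2)) {E. cochromatic_number {1..n} E \<le> k n}"
      \<comment> \<open>By the contrapositive of \<open>bound\<close>, exceeding the target forces
        more than \<open>D\<close> deletions.\<close>
      have "measure_pmf.prob (gnp n (1/2)) {E. real (cochromatic_number {1..n} E) >
              real (k n) + 10 * (D / ln (real n) + real n powr (1/3) + 1)}
          \<le> measure_pmf.prob (gnp n (1/2)) {E. real (deletion_number (k n) {1..n} E) > D}"
        using bound by (intro measure_pmf.finite_measure_mono) (auto simp: not_le[symmetric])
      also have "\<dots> \<le> exp (- r n)"
        unfolding D_def using elim(2) \<Lambda> r
        by (intro deletion_number_upper_tail start) (auto simp: less_imp_le)
      finally show "measure_pmf.prob (gnp n (1/2)) {E. real (cochromatic_number {1..n} E) >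
            real (k n) + 10 * ((sqrt (real n * \<Lambda> n) + sqrt (real n * r n)) / ln (real n)
                              + real n powr (1/3) + 1)} \<le> exp (- r n) + 0"
        by (simp add: D_def)
    qed
  qed
qed auto

end
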